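(* Assume that $J$ and $f$ satisfy the standing assumptions listed in the context, and let $u(t,x)$ be the transition front described in the context. Then, for any $t\in\mathbb{R}$, $u(t,x)$ is continuously differentiable in $x$. Moreover, $u_x(t,x)$ is uniformly bounded and uniformly Lipschitz continuous in $x$, that is, $$\sup_{(t,x)\in\mathbb{R}\times\mathbb{R}}|u_x(t,x)|<\infty\quad\text{and}\quad \sup_{t\in\mathbb{R},\,x\neq y}\left|\frac{u_x(t,x)-u_x(t,y)}{x-y}\right|<\infty .$$
   Context: Equation. Consider $u_t=J*u-u+f(t,u)$, $(t,x)\in\mathbb{R}\times\mathbb{R}$, where $[J*u](t,x)=\int_{\mathbb{R}}J(x-y)u(t,y)\,dy$. Assumptions on $J$: $J\not\equiv 0$, $J\in C^1(\mathbb{R})$, $J(x)=J(-x)\ge 0$ for all $x$, $\int_{\mathbb{R}}J(x)dx=1$, $\int_{\mathbb{R}}|J'(x)|dx<\infty$, and $\int_{\mathbb{R}}J(x)e^{\lambda x}dx<\infty$ for all $\lambda>0$. Assumptions on $f$: $f:\mathbb{R}\times[0,\infty)\to\mathbb{R}$ is continuously differentiable and (a) there are $\theta\in(0,1)$, $f_{\min}\in C^{1,\gamma}([0,1])$ (for some Hölder exponent $\gamma$) and a Lipschitz function $f_{\max}:[0,1]\to\mathbb{R}$ with $f_{\min}(w)=f_{\max}(w)=0$ for $w\in[0,\theta]\cup\{1\}$, $0<f_{\min}(w)\le f_{\max}(w)$ for $w\in(\theta,1)$, $f_{\min}'(1)<0$, such that $f_{\min}(w)\le f(t,w)\le f_{\max}(w)$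 for $(t,w)\in\mathbb{R}\times[0,1]$; (b) $f(t,w)<0$ for $(t,w)\in\mathbb{R}\times(1,\infty)$; (c) $\sup_{\mathbb{R}\times[0,1]}|f_t|<\infty$ and $\sup_{\mathbb{R}\times[0,\infty)}|f_u|<\infty$; (d) there is $\tilde\theta\in(\theta,1)$ with $f_u(t,w)\le 0$ for all $t\in\mathbb{R}$, $w\in[\tilde\theta,1]$; (e) $f(t,u)$ is twice continuously differentiable in $u$ and $\sup_{\mathbb{R}\times[0,1]}|f_{uu}|<\infty$. Approximating solutions (known facts). There are a unique $c^*_{\min}>0$ and a unique $C^1$ function $\phi_{\min}:\mathbb{R}\to(0,1)$ with $J*\phi_{\min}-\phi_{\min}+c^*_{\min}\phi_{\min}'+f_{\min}(\phi_{\min})=0$, $\phi_{\min}'<0$, $\phi_{\min}(0)=\theta$, $\phi_{\min}(-\infty)=1$, $\phi_{\min}(\infty)=0$. For each $s<0$ there is a unique $y_s\in\mathbb{R}$ (with $y_s\to-\infty$ as $s\to-\infty$) such that the classical solution $u(t,x;s)$, $t\ge s$, of the equation with $u(s,x;s)=\phi_{\min}(x-y_s)$ satisfies $u(0,0;s)=\theta$. Each $u(t,x;s)$ is strictly decreasing in $x$ with $u(t,-\infty;s)=1$, $u(t,\infty;s)=0$; for $\lambda\in(0,1)$ let $X_\lambda(t;s)$ be the point with $u(t,X_\lambda(t;s);s)=\lambda$. There are positive constants $c_{\min},c_{\max},c_\pm,h_\pm$ (independent of $s$) and twice continuously differentiable functions $X(\cdot;s):[s,\infty)\to\mathbb{R}$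 such that, for all $s<0$, $t\ge s$: $c_{\min}\le\dot X(t;s)\le c_{\max}$; $\sup_{s<0,t\ge s}|\ddot X(t;s)|<\infty$; $\sup_{s<0,t\ge s}|X(t;s)-X_\lambda(t;s)|<\infty$ for every $\lambda\in(0,1)$; $u(t,x;s)\ge 1-e^{c_-(x-X(t;s)+h_-)}$ for $x\le X(t;s)-h_-$; $u(t,x;s)\le e^{-c_+(x-X(t;s)-h_+)}$ for $x\ge X(t;s)+h_+$. Moreover $u(t,x;s)$ is Lipschitz in $x$ uniformly in $s<0$, $t\ge s$. The transition front. A transition front is an entire solution $u$ with $u(t,-\infty)=1$, $u(t,\infty)=0$ for all $t$ and $\sup_{t\in\mathbb{R}}\mathrm{diam}\{x:\epsilon\le u(t,x)\le 1-\epsilon\}<\infty$ for every $\epsilon\in(0,1)$. Throughout, $u(t,x)$ is the transition front and $X:\mathbb{R}\to\mathbb{R}$ the continuously differentiable function obtained as limits: $X(t;s)\to X(t)$, $u(t,x;s)\to u(t,x)$, $u_t(t,x;s)\to u_t(t,x)$ locally uniformly in $(t,x)\in\mathbb{R}\times\mathbb{R}$ as $s\to-\infty$ along some subsequence. It is known that $u$ is strictly decreasing in $x$ and Lipschitz in $x$ uniformly in $t$, that $\dot X(t)\in[c_{\min},c_{\max}]$ for all $t\in\mathbb{R}$, and that, for all $t\in\mathbb{R}$, $u(t,x)\ge 1-e^{c_-(x-X(t)+h_-)}$ for $x\le X(t)-h_-$ and $u(t,x)\le e^{-c_+(x-X(t)-h_+)}$ for $x\ge X(t)+h_+$. *)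

theory Defs
  imports "HOL-Analysis.Analysis"
begin

text \<open>Derivative relative to a nondegenerate interval \<open>S\<close>: one-sided at an endpoint belonging to
  \<open>S\<close>, and independent of the values of the function outside \<open>S\<close>.\<close>

definition deriv_on :: "real set \<Rightarrow> (real \<Rightarrow> real) \<Rightarrow> real \<Rightarrow> real" where
  "deriv_on S g x = vector_derivative g (at x within S)"

definition C1_on :: "real set \<Rightarrow> (real \<Rightarrow> real) \<Rightarrow> bool" where
  "C1_on S g \<longleftrightarrow> g differentiable_on S \<and> continuous_on S (deriv_on S g)"

definition C2_on :: "real set \<Rightarrow> (real \<Rightarrow> real) \<Rightarrow> bool" where
  "C2_on S g \<longleftrightarrow> C1_on S g \<and> C1_on S (deriv_on S g)"

definition C1_Hoelder_on :: "real \<Rightarrow> real set \<Rightarrow> (real \<Rightarrow> real) \<Rightarrow> bool" where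
  "C1_Hoelder_on \<gamma> S g \<longleftrightarrow> C1_on S g \<and>
     (\<exists>H. \<forall>x\<in>S. \<forall>y\<in>S. \<bar>deriv_on S g x - deriv_on S g y\<bar> \<le> H * \<bar>x - y\<bar> powr \<gamma>)"

text \<open>Partial derivatives of a function on the closed half plane
  \<open>{(t, w). w \<ge> 0}\<close>; its values for \<open>w < 0\<close> are irrelevant.\<close>

definition f_t :: "(real \<Rightarrow> real \<Rightarrow> real) \<Rightarrow> real \<Rightarrow> real \<Rightarrow> real" where
  "f_t f t w = deriv (\<lambda>\<tau>. f \<tau> w) t"

definition f_u :: "(real \<Rightarrow> real \<Rightarrow> real) \<Rightarrow> real \<Rightarrow> real \<Rightarrow> real" where
  "f_u f t w = deriv_on {0..} (f t) w"

definition f_uu :: "(real \<Rightarrow> real \<Rightarrow> real) \<Rightarrow> real \<Rightarrow> real \<Rightarrow> real" where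
  "f_uu f t w = deriv_on {0..} (f_u f t) w"

definition conv :: "(real \<Rightarrow> real) \<Rightarrow> (real \<Rightarrow> real) \<Rightarrow> real \<Rightarrow> real" where
  "conv J v x = (LBINT y. J (x - y) * v y)"

locale dispersal_kernel =
  fixes J :: "real \<Rightarrow> real"
  assumes J_nonzero: "\<exists>x. J x \<noteq> 0"
    and J_C1: "J C1_differentiable_on UNIV"
    and J_even: "\<And>x. J (- x) = J x"
    and J_nonneg: "\<And>x. 0 \<le> J x"
    and J_integrable: "integrable lborel J"
    and J_integral: "(LBINT x. J x) = 1"
    and J_deriv_integrable: "integrable lborel (\<lambda>x. \<bar>deriv J x\<bar>)"
    and J_exp_integrable: "\<And>\<mu>. \<mu> > 0 \<Longrightarrow> integrable lborel (\<lambda>x. J x * exp (\<mu> * x))"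

locale ignition_reaction =
  fixes f :: "real \<Rightarrow> real \<Rightarrow> real" and f_min f_max :: "real \<Rightarrow> real" and \<theta> :: real
  assumes f_differentiable: "(\<lambda>(t, w). f t w) differentiable_on UNIV \<times> {0..}"
    and f_t_continuous: "continuous_on (UNIV \<times> {0..}) (\<lambda>(t, w). f_t f t w)"
    and f_u_continuous: "continuous_on (UNIV \<times> {0..}) (\<lambda>(t, w). f_u f t w)"
    and theta: "0 < \<theta>" "\<theta> < 1"
    and f_min_C1_Hoelder: "\<exists>\<gamma>. 0 < \<gamma> \<and> \<gamma> \<le> 1 \<and> C1_Hoelder_on \<gamma> {0..1} f_min"
    and f_max_Lipschitz: "\<exists>L. L-lipschitz_on {0..1} f_max"
    and f_min_max_zero: "\<And>w. w \<in> {0..\<theta>} \<union> {1} \<Longrightarrow> f_min w = 0 \<and> f_max w = 0"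
    and f_min_max_pos: "\<And>w. w \<in> {\<theta><..<1} \<Longrightarrow> 0 < f_min w \<and> f_min w \<le> f_max w"
    and f_min_deriv_1: "deriv_on {0..1} f_min 1 < 0"
    and f_between: "\<And>t w. w \<in> {0..1} \<Longrightarrow> f_min w \<le> f t w \<and> f t w \<le> f_max w"
    and f_neg: "\<And>t w. w > 1 \<Longrightarrow> f t w < 0"
    and f_t_bounded: "bdd_above ((\<lambda>(t, w). \<bar>f_t f t w\<bar>) ` (UNIV \<times> {0..1}))"
    and f_u_bounded: "bdd_above ((\<lambda>(t, w). \<bar>f_u f t w\<bar>) ` (UNIV \<times> {0..}))"
    and f_u_nonpos: "\<exists>\<theta>'. \<theta> < \<theta>' \<and> \<theta>' < 1 \<and> (\<forall>t. \<forall>w\<in>{\<theta>'..1}. f_u f t w \<le> 0)"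
    and f_C2_in_u: "\<And>t. C2_on {0..} (f t)"
    and f_uu_bounded: "bdd_above ((\<lambda>(t, w). \<bar>f_uu f t w\<bar>) ` (UNIV \<times> {0..1}))"

text \<open>Classical solutions of \<open>u\<^sub>t = J * u - u + f(t, u)\<close> on the time interval \<open>T\<close>.  Nonnegativity
  is part of the notion because \<open>f(t, \<cdot>)\<close> is only given on \<open>[0, \<infinity>)\<close>; integrability makes \<open>J * u\<close>
  meaningful, as the Bochner integral of a nonintegrable function is 0 by convention.\<close>

definition classical_solution ::
  "(real \<Rightarrow> real) \<Rightarrow> (real \<Rightarrow> real \<Rightarrow> real) \<Rightarrow> real set \<Rightarrow> (real \<Rightarrow> real \<Rightarrow> real) \<Rightarrow> bool" where
  "classical_solution J f T u \<longleftrightarrow>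
     continuous_on (T \<times> UNIV) (\<lambda>(t, x). u t x) \<and>
     (\<forall>t\<in>T. \<forall>x. 0 \<le> u t x \<and>
        integrable lborel (\<lambda>y. J (x - y) * u t y) \<and>
        ((\<lambda>\<tau>. u \<tau> x) has_real_derivative (conv J (u t) x - u t x + f t (u t x))) (at t within T))"

text \<open>\<open>level_point v \<mu>\<close> is meant for continuous strictly decreasing \<open>v\<close> with limits 1 and 0, and
  \<open>0 < \<mu> < 1\<close>.\<close>

definition level_point :: "(real \<Rightarrow> real) \<Rightarrow> real \<Rightarrow> real" where
  "level_point v \<mu> = (THE x. v x = \<mu>)"

definition min_wave ::
  "(real \<Rightarrow> real) \<Rightarrow> (real \<Rightarrow> real) \<Rightarrow> real \<Rightarrow> real \<Rightarrow> (real \<Rightarrow> real) \<Rightarrow> bool" where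
  "min_wave J f_min \<theta> c \<phi> \<longleftrightarrow>
     c > 0 \<and> \<phi> C1_differentiable_on UNIV \<and> (\<forall>x. 0 < \<phi> x \<and> \<phi> x < 1) \<and>
     (\<forall>x. conv J \<phi> x - \<phi> x + c * deriv \<phi> x + f_min (\<phi> x) = 0) \<and>
     (\<forall>x. deriv \<phi> x < 0) \<and> \<phi> 0 = \<theta> \<and>
     (\<phi> \<longlongrightarrow> 1) at_bot \<and> (\<phi> \<longlongrightarrow> 0) at_top"

text \<open>The diameter of an unbounded set is a junk value, hence the explicit boundedness.\<close>

definition transition_front ::
  "(real \<Rightarrow> real) \<Rightarrow> (real \<Rightarrow> real \<Rightarrow> real) \<Rightarrow> (real \<Rightarrow> real \<Rightarrow> real) \<Rightarrow> bool" where
  "transition_front J f u \<longleftrightarrow>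
     classical_solution J f UNIV u \<and>
     (\<forall>t. (u t \<longlongrightarrow> 1) at_bot \<and> (u t \<longlongrightarrow> 0) at_top) \<and>
     (\<forall>\<epsilon>\<in>{0<..<1}. (\<forall>t. bounded {x. \<epsilon> \<le> u t x \<and> u t x \<le> 1 - \<epsilon>}) \<and>
        bdd_above (range (\<lambda>t. diameter {x. \<epsilon> \<le> u t x \<and> u t x \<le> 1 - \<epsilon>})))"

text \<open>\<open>U s t x\<close> and \<open>\<xi> s t\<close> stand for \<open>u(t, x; s)\<close> and \<open>X(t; s)\<close>; only \<open>s < 0\<close> and \<open>t \<ge> s\<close>
  are relevant.\<close>

locale approximating_solutions =
  dispersal_kernel J + ignition_reaction f f_min f_max \<theta>
  for J :: "real \<Rightarrow> real" and f :: "real \<Rightarrow> real \<Rightarrow> real"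
    and f_min f_max :: "real \<Rightarrow> real" and \<theta> :: real +
  fixes c_star :: real and \<phi>_min :: "real \<Rightarrow> real" and y :: "real \<Rightarrow> real"
    and U :: "real \<Rightarrow> real \<Rightarrow> real \<Rightarrow> real" and \<xi> :: "real \<Rightarrow> real \<Rightarrow> real"
    and c_min c_max c_minus c_plus h_minus h_plus :: real
  assumes wave: "min_wave J f_min \<theta> c_star \<phi>_min"
    and y_at_bot: "filterlim y at_bot at_bot"
    and U_solution: "\<And>s. s < 0 \<Longrightarrow> classical_solution J f {s..} (U s)"
    and U_initial: "\<And>s x. s < 0 \<Longrightarrow> U s s x = \<phi>_min (x - y s)"
    and U_normalized: "\<And>s. s < 0 \<Longrightarrow> U s 0 0 = \<theta>"
    and U_decreasing: "\<And>s t x x'. s < 0 \<Longrightarrow> s \<le> t \<Longrightarrow> x < x' \<Longrightarrow> U s t x' < U s t x"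
    and U_at_bot: "\<And>s t. s < 0 \<Longrightarrow> s \<le> t \<Longrightarrow> (U s t \<longlongrightarrow> 1) at_bot"
    and U_at_top: "\<And>s t. s < 0 \<Longrightarrow> s \<le> t \<Longrightarrow> (U s t \<longlongrightarrow> 0) at_top"
    and U_Lipschitz: "\<exists>L. \<forall>s t. s < 0 \<longrightarrow> s \<le> t \<longrightarrow> L-lipschitz_on UNIV (U s t)"
    and constants_pos: "0 < c_min" "0 < c_max" "0 < c_minus" "0 < c_plus" "0 < h_minus" "0 < h_plus"
    and xi_C2: "\<And>s. s < 0 \<Longrightarrow> C2_on {s..} (\<xi> s)"
    and xi_speed: "\<And>s t. s < 0 \<Longrightarrow> s \<le> t \<Longrightarrow>
      c_min \<le> deriv_on {s..} (\<xi> s) t \<and> deriv_on {s..} (\<xi> s) t \<le> c_max"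
    and xi_acceleration:
      "bdd_above {\<bar>deriv_on {s..} (deriv_on {s..} (\<xi> s)) t\<bar> | s t. s < 0 \<and> s \<le> t}"
    and xi_level: "\<And>\<mu>. 0 < \<mu> \<Longrightarrow> \<mu> < 1 \<Longrightarrow>
      bdd_above {\<bar>\<xi> s t - level_point (U s t) \<mu>\<bar> | s t. s < 0 \<and> s \<le> t}"
    and U_behind: "\<And>s t x. s < 0 \<Longrightarrow> s \<le> t \<Longrightarrow> x \<le> \<xi> s t - h_minus \<Longrightarrow>
      1 - exp (c_minus * (x - \<xi> s t + h_minus)) \<le> U s t x"
    and U_ahead: "\<And>s t x. s < 0 \<Longrightarrow> s \<le> t \<Longrightarrow> \<xi> s t + h_plus \<le> x \<Longrightarrow>
      U s t x \<le> exp (- c_plus * (x - \<xi> s t - h_plus))"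

text \<open>\<open>\<sigma>\<close> enumerates the initial times of the subsequence along which the limits are taken.  For
  each fixed \<open>t\<close> eventually \<open>\<sigma> n < t\<close>, so the two-sided time derivative of \<open>U (\<sigma> n)\<close> at \<open>t\<close> and
  the values of \<open>U (\<sigma> n)\<close>, \<open>\<xi> (\<sigma> n)\<close> on a given compact set are eventually the intended ones.\<close>

locale limiting_transition_front =
  approximating_solutions J f f_min f_max \<theta> c_star \<phi>_min y U \<xi> c_min c_max c_minus c_plus h_minus h_plus
  for J :: "real \<Rightarrow> real" and f :: "real \<Rightarrow> real \<Rightarrow> real"
    and f_min f_max :: "real \<Rightarrow> real" and \<theta> :: real
    and c_star :: real and \<phi>_min :: "real \<Rightarrow> real" and y :: "real \<Rightarrow> real"
    and U :: "real \<Rightarrow> real \<Rightarrow> real \<Rightarrow> real" and \<xi> :: "real \<Rightarrow> real \<Rightarrow> real"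
    and c_min c_max c_minus c_plus h_minus h_plus :: real +
  fixes \<sigma> :: "nat \<Rightarrow> real" and u :: "real \<Rightarrow> real \<Rightarrow> real" and X :: "real \<Rightarrow> real"
  assumes sigma_neg: "\<And>n. \<sigma> n < 0"
    and sigma_at_bot: "filterlim \<sigma> at_bot sequentially"
    and front: "transition_front J f u"
    and X_C1: "X C1_differentiable_on UNIV"
    and X_limit: "\<And>K. compact K \<Longrightarrow> uniform_limit K (\<lambda>n. \<xi> (\<sigma> n)) X sequentially"
    and u_limit: "\<And>K. compact K \<Longrightarrow>
      uniform_limit K (\<lambda>n (t, x). U (\<sigma> n) t x) (\<lambda>(t, x). u t x) sequentially"
    and u_t_limit: "\<And>K. compact K \<Longrightarrow>
      uniform_limit K (\<lambda>n (t, x). deriv (\<lambda>\<tau>. U (\<sigma> n) \<tau> x) t)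
        (\<lambda>(t, x). deriv (\<lambda>\<tau>. u \<tau> x) t) sequentially"
    and u_decreasing: "\<And>t x x'. x < x' \<Longrightarrow> u t x' < u t x"
    and u_Lipschitz: "\<exists>L. \<forall>t. L-lipschitz_on UNIV (u t)"
    and X_speed: "\<And>t. c_min \<le> deriv X t \<and> deriv X t \<le> c_max"
    and u_behind: "\<And>t x. x \<le> X t - h_minus \<Longrightarrow>
      1 - exp (c_minus * (x - X t + h_minus)) \<le> u t x"
    and u_ahead: "\<And>t x. X t + h_plus \<le> x \<Longrightarrow>
      u t x \<le> exp (- c_plus * (x - X t - h_plus))"

end

theory Submission
  imports Defs
begin

text \<open>The regularity of \<open>u\<close> in \<open>x\<close> is read off its difference quotients
  \<open>Q\<^sub>h(t) = (u(t, x + h) - u(t, x)) / h\<close>.  There is no spatial smoothing in the equation, so a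
  regularity gain can come only from the long history of the entire solution.  For fixed \<open>x\<close> the
  quotients solve linear ordinary differential equations in \<open>t\<close>,
  \<open>Q\<^sub>h' = (a - 1) Q\<^sub>h + (J' * u)(t, x) + O(h)\<close> with \<open>a(t) = f\<^sub>u(t, u(t, x))\<close>,
  in which the coefficient \<open>a\<close> and the source \<open>J' * u\<close> do not depend on \<open>h\<close>.  The error is \<open>O(h)\<close> uniformly in \<open>t\<close> and \<open>x\<close>, because
  \<open>u\<close> is uniformly Lipschitz in \<open>x\<close>, \<open>f\<^sub>u\<close> is Lipschitz in its second variable, and \<open>J'\<close> is
  integrable, so that \<open>J * u\<close> has a Lipschitz derivative (\<open>conv_taylor\<close>).

  Hence \<open>w = Q\<^sub>h - Q\<^sub>k\<close> is a bounded entire solution of \<open>w' = (a - 1) w + g\<close> with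
  \<open>g = O(\<bar>h\<bar> + \<bar>k\<bar>)\<close>.  The coefficient \<open>a\<close> may well exceed 1, but only while the front passes the
  point \<open>x\<close>: before that \<open>u\<close> is below the ignition threshold and \<open>a = 0\<close>, after that \<open>u\<close> is near 1
  and \<open>a \<le> 0\<close>.  As the front moves with speed at least \<open>c\<^sub>m\<^sub>i\<^sub>n > 0\<close> and has bounded width, the
  passage takes a time bounded independently of \<open>x\<close> (\<open>transition_time_bounded\<close>).  Outside it \<open>w\<close>
  is damped, which also makes it forget its initial value at \<open>t = -\<infinity>\<close>; within it \<open>w\<close> grows by at
  most a fixed factor.  So \<open>w = O(\<bar>h\<bar> + \<bar>k\<bar>)\<close> uniformly (\<open>bounded_entire_solution_bound\<close>).

  This single estimate contains everything: the quotients converge as \<open>h \<rightarrow> 0\<close>, and since the chord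
  from \<open>x\<close> to \<open>x'\<close> is a difference quotient based at either of its end points, the limits at \<open>x\<close> and
  \<open>x'\<close> differ by \<open>O(\<bar>x - x'\<bar>)\<close> (\<open>derivative_of_Cauchy_difference_quotients\<close>).\<close>

section \<open>Functions whose difference quotients are uniformly Cauchy\<close>

text \<open>Mean value theorem for \<open>z \<mapsto> F z - F' a * z\<close>, whose derivative is at most \<open>K * \<bar>b - a\<bar>\<close>
  between \<open>a\<close> and \<open>b\<close>.\<close>

lemma taylor_remainder_of_Lipschitz_derivative:
  fixes F F' :: "real \<Rightarrow> real"
  assumes "convex S"
    and deriv: "\<And>z. z \<in> S \<Longrightarrow> (F has_real_derivative F' z) (at z within S)"
    and lip: "\<And>z z'. z \<in> S \<Longrightarrow> z' \<in> S \<Longrightarrow> \<bar>F' z - F' z'\<bar> \<le> K * \<bar>z - z'\<bar>"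
    and "0 \<le> K" "a \<in> S" "b \<in> S"
  shows "\<bar>F b - F a - F' a * (b - a)\<bar> \<le> K * (b - a)\<^sup>2"
proof -
  define T where "T = closed_segment a b"
  have T: "T \<subseteq> S" unfolding T_def using assms by (simp add: closed_segment_subset)
  have near: "\<bar>z - a\<bar> \<le> \<bar>b - a\<bar>" if "z \<in> T" for z
    using that by (auto simp: T_def closed_segment_eq_real_ivl split: if_splits)
  have "norm ((F b - F' a * b) - (F a - F' a * a)) \<le> (K * \<bar>b - a\<bar>) * norm (b - a)"
  proof (rule field_differentiable_bound[where S = T and f = "\<lambda>z. F z - F' a * z"
        and f' = "\<lambda>z. F' z - F' a"])
    show "convex T" by (simp add: T_def)
    show "((\<lambda>z. F z - F' a * z) has_real_derivative F' z - F' a) (at z within T)" if "z \<in> T" for z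
      using DERIV_subset[OF deriv T] T that by (auto intro!: derivative_eq_intros)
    show "norm (F' z - F' a) \<le> K * \<bar>b - a\<bar>" if "z \<in> T" for z
      using order_trans[OF lip[of z a] mult_left_mono[OF near[OF that] \<open>0 \<le> K\<close>]] T that \<open>a \<in> S\<close>
      by auto
  qed (auto simp: T_def)
  then show ?thesis by (simp add: algebra_simps power2_eq_square abs_mult[symmetric])
qed

text \<open>The quotients over \<open>h\<close> converge at the rate \<open>C * \<bar>h\<bar>\<close>.  The chord over the interval between
  \<open>x\<close> and \<open>x'\<close> is therefore within \<open>C * \<bar>x - x'\<bar>\<close> of the derivative at both end points, which gives
  the factor 2.\<close>

lemma derivative_of_Cauchy_difference_quotients:
  fixes w :: "real \<Rightarrow> real"
  assumes C: "\<And>x h k. h \<noteq> 0 \<Longrightarrow> k \<noteq> 0 \<Longrightarrow>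
      \<bar>(w (x + h) - w x) / h - (w (x + k) - w x) / k\<bar> \<le> C * (\<bar>h\<bar> + \<bar>k\<bar>)"
  shows "(w has_real_derivative deriv w x) (at x)"
    and "\<bar>deriv w x - deriv w x'\<bar> \<le> 2 * C * \<bar>x - x'\<bar>"
proof -
  define Q where "Q x h = (w (x + h) - w x) / h" for x h
  have Q: "\<bar>Q x h - Q x k\<bar> \<le> C * (\<bar>h\<bar> + \<bar>k\<bar>)" if "h \<noteq> 0" "k \<noteq> 0" for x h k
    using C[OF that] by (simp add: Q_def)
  define e where "e n = inverse (real (Suc n))" for n
  have e: "e \<longlonglongrightarrow> 0" "\<And>n. e n > 0"
    unfolding e_def by (rule LIMSEQ_inverse_real_of_nat) simp
  define p where "p x = lim (\<lambda>n. Q x (e n))" for x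
  have "convergent (\<lambda>n. Q x (e n))" for x
  proof (rule Cauchy_convergent, rule CauchyI')
    fix \<epsilon> :: real assume "\<epsilon> > 0"
    have "(\<lambda>n. \<bar>C\<bar> * (2 * e n)) \<longlonglongrightarrow> \<bar>C\<bar> * (2 * 0)" by (intro tendsto_intros e)
    then have "\<forall>\<^sub>F n in sequentially. \<bar>C\<bar> * (2 * e n) < \<epsilon>"
      using \<open>\<epsilon> > 0\<close> by (intro order_tendstoD(2)[of _ "0::real"]) auto
    then obtain N where N: "\<bar>C\<bar> * (2 * e N) < \<epsilon>" by (auto simp: eventually_sequentially)
    have "dist (Q x (e m)) (Q x (e n)) < \<epsilon>" if "N \<le> m" "m < n" for m n
    proof -
      have "e m \<le> e N" "e n \<le> e N" using that by (auto simp: e_def field_simps)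
      then have "\<bar>C\<bar> * (\<bar>e m\<bar> + \<bar>e n\<bar>) \<le> \<bar>C\<bar> * (2 * e N)"
        using e(2)[of m] e(2)[of n] by (intro mult_left_mono) auto
      moreover have "C * (\<bar>e m\<bar> + \<bar>e n\<bar>) \<le> \<bar>C\<bar> * (\<bar>e m\<bar> + \<bar>e n\<bar>)"
        by (intro mult_right_mono) auto
      moreover have "\<bar>Q x (e m) - Q x (e n)\<bar> \<le> C * (\<bar>e m\<bar> + \<bar>e n\<bar>)"
        using e(2)[of m] e(2)[of n] by (intro Q) auto
      ultimately show ?thesis using N unfolding dist_real_def by linarith
    qed
    then show "\<exists>M. \<forall>m\<ge>M. \<forall>n>m. dist (Q x (e m)) (Q x (e n)) < \<epsilon>" by blast
  qed
  then have p: "(\<lambda>n. Q x (e n)) \<longlonglongrightarrow> p x" for x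
    unfolding p_def by (simp add: convergent_LIMSEQ_iff)
  have Qp: "\<bar>Q x h - p x\<bar> \<le> C * \<bar>h\<bar>" if "h \<noteq> 0" for x h
  proof -
    have "(\<lambda>n. \<bar>Q x h - Q x (e n)\<bar>) \<longlonglongrightarrow> \<bar>Q x h - p x\<bar>"
      "(\<lambda>n. C * (\<bar>h\<bar> + \<bar>e n\<bar>)) \<longlonglongrightarrow> C * (\<bar>h\<bar> + \<bar>0\<bar>)"
      by (intro tendsto_intros p e)+
    then have "\<bar>Q x h - p x\<bar> \<le> C * (\<bar>h\<bar> + \<bar>0\<bar>)"
    proof (rule LIMSEQ_le)
      show "\<exists>N. \<forall>n\<ge>N. \<bar>Q x h - Q x (e n)\<bar> \<le> C * (\<bar>h\<bar> + \<bar>e n\<bar>)"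
        using e(2)[THEN less_imp_neq, symmetric] by (intro exI[of _ 0] allI impI Q that) auto
    qed
    then show ?thesis by simp
  qed
  have D: "(w has_real_derivative p x) (at x)" for x
    unfolding has_field_derivative_iff
  proof -
    have lim0: "(\<lambda>h::real. C * \<bar>h - x\<bar>) \<midarrow>x\<rightarrow> 0"
      by (auto intro!: tendsto_eq_intros)
    have "(\<lambda>y. (w y - w x) / (y - x) - p x) \<midarrow>x\<rightarrow> 0"
    proof (rule Lim_null_comparison[OF _ lim0])
      show "\<forall>\<^sub>F y in at x. norm ((w y - w x) / (y - x) - p x) \<le> C * \<bar>y - x\<bar>"
        unfolding eventually_at_filter
        using Qp[of "_ - x" x] by (auto simp: Q_def)
    qed
    then show "(\<lambda>y. (w y - w x) / (y - x)) \<midarrow>x\<rightarrow> p x" by (simp add: LIM_zero_iff)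
  qed
  then have p_eq: "deriv w = p" by (auto intro: DERIV_imp_deriv)
  show "(w has_real_derivative deriv w x) (at x)" using D p_eq by simp
  show "\<bar>deriv w x - deriv w x'\<bar> \<le> 2 * C * \<bar>x - x'\<bar>"
  proof (cases "x = x'")
    case False
    \<comment> \<open>Both are the slope of the chord over the interval between \<open>x\<close> and \<open>x'\<close>.\<close>
    have "Q x (x' - x) = Q x' (x - x')" using False by (simp add: Q_def field_simps)
    then show ?thesis
      using Qp[of "x' - x" x] Qp[of "x - x'" x'] False by (simp add: p_eq abs_minus_commute)
  qed simp
qed

section \<open>Convolution against a kernel with integrable derivative\<close>

lemma conv_shifted: "conv K v x = (LBINT z. K z * v (x - z))"
  unfolding conv_def
  by (subst lborel_integral_real_affine[where c = "-1" and t = x]) auto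

lemma integrable_conv_integrand:
  fixes K v :: "real \<Rightarrow> real"
  assumes "integrable lborel K" "v \<in> borel_measurable borel" "\<And>x. \<bar>v x\<bar> \<le> 1"
  shows "integrable lborel (\<lambda>y. K (x - y) * v y)"
proof -
  have i: "integrable lborel (\<lambda>y. K (x - y))"
    using lborel_integrable_real_affine[OF assms(1), of "-1" x] by simp
  have [measurable]: "K \<in> borel_measurable borel" using assms(1) by auto
  note [measurable] = assms(2)
  show ?thesis
    by (rule Bochner_Integration.integrable_bound[OF i])
       (auto simp: abs_mult intro!: mult_left_le assms AE_I2)
qed

lemma conv_abs_le:
  fixes K v :: "real \<Rightarrow> real"
  assumes "integrable lborel K" "\<And>x. \<bar>v x\<bar> \<le> 1"
  shows "(LBINT y. \<bar>K (x - y) * v y\<bar>) \<le> (LBINT z. \<bar>K z\<bar>)"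
proof -
  have "integrable lborel (\<lambda>y. K (x - y))"
    using lborel_integrable_real_affine[OF assms(1), of "-1" x] by simp
  then have "(LBINT y. \<bar>K (x - y) * v y\<bar>) \<le> (LBINT y. \<bar>K (x - y)\<bar>)"
    by (intro integral_mono') (auto simp: abs_mult intro!: mult_left_le assms)
  also have "\<dots> = (LBINT z. \<bar>K z\<bar>)"
    by (subst lborel_integral_real_affine[where c = "-1" and t = x]) auto
  finally show ?thesis .
qed

lemma conv_Lipschitz:
  fixes K v :: "real \<Rightarrow> real"
  assumes "integrable lborel K" "\<And>x. \<bar>v x\<bar> \<le> 1" 
    and lip: "\<And>x y. \<bar>v x - v y\<bar> \<le> L * \<bar>x - y\<bar>"
    and v: "v \<in> borel_measurable borel"
  shows "\<bar>conv K v x - conv K v x'\<bar> \<le> L * (LBINT z. \<bar>K z\<bar>) * \<bar>x - x'\<bar>"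
proof -
  have i: "integrable lborel (\<lambda>z. K z * v (x - z))" for x
    using lborel_integrable_real_affine[OF integrable_conv_integrand[OF assms(1) v assms(2)], of "-1" x x]
    by simp
  have "conv K v x - conv K v x' = (LBINT z. K z * v (x - z) - K z * v (x' - z))"
    unfolding conv_shifted by (rule Bochner_Integration.integral_diff[symmetric]) (rule i)+
  also have "\<bar>\<dots>\<bar> \<le> (LBINT z. \<bar>K z * v (x - z) - K z * v (x' - z)\<bar>)"
    by (rule integral_abs_bound)
  also have "\<dots> \<le> (LBINT z. \<bar>K z\<bar> * (L * \<bar>x - x'\<bar>))"
  proof (rule integral_mono')
    show "integrable lborel (\<lambda>z. \<bar>K z\<bar> * (L * \<bar>x - x'\<bar>))" using assms(1) by simp
    show "\<bar>K z * v (x - z) - K z * v (x' - z)\<bar> \<le> \<bar>K z\<bar> * (L * \<bar>x - x'\<bar>)" for z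
      using lip[of "x - z" "x' - z"]
      by (simp add: right_diff_distrib[symmetric] abs_mult mult_left_mono)
    show "0 \<le> \<bar>K z\<bar> * (L * \<bar>x - x'\<bar>)" for z
      using order_trans[OF abs_ge_zero lip] by simp
  qed
  finally show ?thesis by (simp add: algebra_simps)
qed

text \<open>The fundamental theorem of calculus applied to \<open>J (x + r - y)\<close> in \<open>r\<close>, followed by Fubini.
  Differentiation under the integral sign is not applicable directly: an integrable \<open>J'\<close> need not have
  an integrable majorant that is locally uniform in its translates.\<close>

lemma conv_increment:
  fixes J J' v :: "real \<Rightarrow> real"
  assumes J: "integrable lborel J" and J': "integrable lborel J'"
    and deriv: "\<And>x. (J has_real_derivative J' x) (at x)"
    and cont: "continuous_on UNIV J'"
    and v: "v \<in> borel_measurable borel" "\<And>x. \<bar>v x\<bar> \<le> 1"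
    and "0 \<le> h"
  shows "integrable lborel (\<lambda>r. indicator {0..h} r * conv J' v (x + r))"
    and "conv J v (x + h) - conv J v x = (LBINT r. indicator {0..h} r * conv J' v (x + r))"
proof -
  define N where "N = (LBINT z. \<bar>J' z\<bar>)"
  define \<psi> where "\<psi> = (\<lambda>p::real \<times> real. indicator {0..h} (fst p) * (J' (x + fst p - snd p) * v (snd p)))"
  have [measurable]: "J' \<in> borel_measurable borel" "v \<in> borel_measurable borel"
    using J' v by auto
  have meas [measurable]: "\<psi> \<in> borel_measurable (lborel \<Otimes>\<^sub>M lborel)"
    unfolding \<psi>_def by measurable
  have sect: "integrable lborel (\<lambda>y. \<psi> (r, y))" for r
    unfolding \<psi>_def using integrable_conv_integrand[OF J' v, of "x + r"] by simp
  have int: "integrable (lborel \<Otimes>\<^sub>M lborel) \<psi>"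
  proof (rule lborel_pair.Fubini_integrable[OF meas])
    show "integrable lborel (\<lambda>r. LBINT y. norm (\<psi> (r, y)))"
    proof (rule Bochner_Integration.integrable_bound)
      show "integrable lborel (\<lambda>r. indicator {0..h} r * N)"
        by (intro integrable_mult_left integrable_real_indicator) (auto simp: emeasure_lborel_Icc_eq)
      show "AE r in lborel. norm (LBINT y. norm (\<psi> (r, y))) \<le> norm (indicator {0..h} r * N)"
      proof (rule AE_I2)
        fix r
        have "(LBINT y. norm (\<psi> (r, y))) = indicator {0..h} r * (LBINT y. \<bar>J' (x + r - y) * v y\<bar>)"
          by (simp add: \<psi>_def abs_mult)
        moreover have "0 \<le> (LBINT y. \<bar>J' (x + r - y) * v y\<bar>)" by simp
        ultimately show "norm (LBINT y. norm (\<psi> (r, y))) \<le> norm (indicator {0..h} r * N)"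
          using conv_abs_le[OF J' v(2), of "x + r"]
          by (auto simp: N_def split: split_indicator)
      qed
    qed measurable
    show "AE r in lborel. integrable lborel (\<lambda>y. \<psi> (r, y))" using sect by simp
  qed
  have r_int: "(LBINT y. \<psi> (r, y)) = indicator {0..h} r * conv J' v (x + r)" for r
    unfolding \<psi>_def conv_def by simp
  show "integrable lborel (\<lambda>r. indicator {0..h} r * conv J' v (x + r))"
    using lborel_pair.integrable_fst'[OF int] by (simp add: r_int)
  have y_int: "(LBINT r. \<psi> (r, y)) = J (x + h - y) * v y - J (x - y) * v y" for y
  proof -
    have "(LBINT r. indicator {0..h} r *\<^sub>R J' (x + r - y)) = J (x + h - y) - J (x + 0 - y)"
    proof (rule integral_FTC_atLeastAtMost[OF \<open>0 \<le> h\<close>])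
      show "((\<lambda>r. J (x + r - y)) has_vector_derivative J' (x + r - y)) (at r within {0..h})" for r
        unfolding has_real_derivative_iff_has_vector_derivative[symmetric]
        by (rule DERIV_cong[OF DERIV_chain2[OF deriv]]) (auto intro!: derivative_eq_intros)
      show "continuous_on {0..h} (\<lambda>r. J' (x + r - y))"
        by (intro continuous_on_compose2[OF cont] continuous_intros) auto
    qed
    moreover have "(LBINT r. \<psi> (r, y)) = (LBINT r. (indicator {0..h} r *\<^sub>R J' (x + r - y)) * v y)"
      unfolding \<psi>_def by (intro Bochner_Integration.integral_cong) auto
    ultimately have "(LBINT r. \<psi> (r, y)) = (J (x + h - y) - J (x + 0 - y)) * v y" by simp
    then show ?thesis by (simp add: left_diff_distrib)
  qed
  have "conv J v (x + h) - conv J v x = (LBINT y. LBINT r. \<psi> (r, y))"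
    unfolding y_int unfolding conv_def
    by (rule Bochner_Integration.integral_diff[symmetric]) (rule integrable_conv_integrand[OF J v])+
  also have "\<dots> = (LBINT r. LBINT y. \<psi> (r, y))"
    using lborel_pair.Fubini_integral[of "\<lambda>r y. \<psi> (r, y)"] int by simp
  finally show "conv J v (x + h) - conv J v x = (LBINT r. indicator {0..h} r * conv J' v (x + r))"
    by (simp add: r_int)
qed

text \<open>The increment of \<open>J * v\<close> is the integral of the Lipschitz function \<open>J' * v\<close>.  The factor 2 pays for
  reducing a negative step to a positive step from the other end point.\<close>

lemma conv_taylor:
  fixes J J' v :: "real \<Rightarrow> real"
  assumes J: "integrable lborel J" and J': "integrable lborel J'"
    and deriv: "\<And>x. (J has_real_derivative J' x) (at x)"
    and cont: "continuous_on UNIV J'"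
    and v: "v \<in> borel_measurable borel" "\<And>x. \<bar>v x\<bar> \<le> 1"
    and lip: "\<And>x y. \<bar>v x - v y\<bar> \<le> L * \<bar>x - y\<bar>"
  shows "\<bar>conv J v (x + h) - conv J v x - h * conv J' v x\<bar> \<le> 2 * (L * (LBINT z. \<bar>J' z\<bar>)) * h\<^sup>2"
proof -
  define M where "M = L * (LBINT z. \<bar>J' z\<bar>)"
  have "0 \<le> L" using order_trans[OF abs_ge_zero lip[of 1 0]] by simp
  then have M0: "0 \<le> M" by (simp add: M_def)
  have g_lip: "\<bar>conv J' v x - conv J' v x'\<bar> \<le> M * \<bar>x - x'\<bar>" for x x'
    unfolding M_def by (rule conv_Lipschitz[OF J' v(2) lip v(1)])
  have pos: "\<bar>conv J v (x + h) - conv J v x - h * conv J' v x\<bar> \<le> M * h\<^sup>2" if "0 \<le> h" for x h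
  proof -
    note inc = conv_increment[OF J J' deriv cont v that, of x]
    have const: "(LBINT r. indicator {0..h} r * c) = h * c" "integrable lborel (\<lambda>r. indicator {0..h} r * c)"
      for c :: real
      using that integrable_mult_left[OF integrable_real_indicator[of "{0..h}" lborel], of c]
      by (auto simp: emeasure_lborel_Icc_eq)
    define \<rho> where
      "\<rho> r = indicator {0..h} r * conv J' v (x + r) - indicator {0..h} r * conv J' v x" for r
    have eq: "conv J v (x + h) - conv J v x - h * conv J' v x = (LBINT r. \<rho> r)"
      unfolding \<rho>_def
      by (subst Bochner_Integration.integral_diff[OF inc(1) const(2)]) (simp only: inc(2) const(1))
    have "\<bar>LBINT r. \<rho> r\<bar> \<le> (LBINT r. \<bar>\<rho> r\<bar>)" by (rule integral_abs_bound)
    also have "\<dots> \<le> (LBINT r. indicator {0..h} r * (M * h))"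
    proof (rule integral_mono'[OF const(2)])
      fix r :: real
      have "M * r \<le> M * h" if "r \<le> h" using that M0 by (rule mult_left_mono)
      then show "\<bar>\<rho> r\<bar> \<le> indicator {0..h} r * (M * h)"
        using g_lip[of "x + r" x] by (auto simp: \<rho>_def split: split_indicator)
    qed (use M0 that in simp)
    also have "\<dots> = h * (M * h)" by (rule const(1))
    also have "\<dots> = M * h\<^sup>2" by (simp add: power2_eq_square)
    finally show ?thesis unfolding eq .
  qed
  show ?thesis
  proof (cases "0 \<le> h")
    case True
    moreover have "0 \<le> M * h\<^sup>2" using M0 by simp
    ultimately show ?thesis using pos[OF True, of x] by (simp add: M_def[symmetric])
  next
    case False
    have "\<bar>h * conv J' v (x + h) - h * conv J' v x\<bar> = \<bar>h\<bar> * \<bar>conv J' v (x + h) - conv J' v x\<bar>"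
      by (simp add: abs_mult[symmetric] algebra_simps)
    also have "\<dots> \<le> \<bar>h\<bar> * (M * \<bar>h\<bar>)" using g_lip[of "x + h" x] by (intro mult_left_mono) auto
    also have "\<dots> = M * h\<^sup>2" by (simp add: power2_eq_square)
    finally show ?thesis
      using pos[of "- h" "x + h"] False by (simp add: M_def[symmetric])
  qed
qed

section \<open>Bounded entire solutions of a linear equation\<close>

text \<open>Multiplication by the integrating factor \<open>exp (- Q)\<close>, with \<open>Q\<close> an antiderivative of \<open>q\<close>, makes \<open>d\<close>
  nondecreasing.\<close>

lemma comparison_principle:
  fixes d d' q :: "real \<Rightarrow> real"
  assumes "s \<le> t"
    and deriv: "\<And>r. (d has_real_derivative d' r) (at r)"
    and cont: "continuous_on UNIV q"
    and ineq: "\<And>r. s \<le> r \<Longrightarrow> r \<le> t \<Longrightarrow> q r * d r \<le> d' r"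
    and init: "0 \<le> d s"
  shows "0 \<le> d t"
proof -
  obtain Q where Q: "\<And>r. r \<in> {s..t} \<Longrightarrow> (Q has_vector_derivative q r) (at r within {s..t})"
    using antiderivative_continuous[OF continuous_on_subset[OF cont subset_UNIV], of s t] by blast
  have "d s * exp (- Q s) \<le> d t * exp (- Q t)"
  proof (rule DERIV_nonneg_imp_increasing_open[OF \<open>s \<le> t\<close>])
    fix r assume r: "s < r" "r < t"
    have Qr: "(Q has_real_derivative q r) (at r)"
      using Q[of r] r at_within_interior[of r "{s..t}"]
      by (simp add: has_real_derivative_iff_has_vector_derivative)
    show "\<exists>y. ((\<lambda>r. d r * exp (- Q r)) has_real_derivative y) (at r) \<and> 0 \<le> y"
    proof (intro exI conjI)
      show "((\<lambda>r. d r * exp (- Q r)) has_real_derivative (d' r - q r * d r) * exp (- Q r)) (at r)"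
        by (auto intro!: derivative_eq_intros deriv Qr simp: algebra_simps)
      show "0 \<le> (d' r - q r * d r) * exp (- Q r)" using ineq[of r] r by simp
    qed
  next
    have "continuous_on {s..t} Q"
      using Q has_vector_derivative_continuous continuous_on_eq_continuous_within by blast
    moreover have "continuous_on {s..t} d"
      using deriv DERIV_isCont continuous_at_imp_continuous_on by blast
    ultimately show "continuous_on {s..t} (\<lambda>r. d r * exp (- Q r))" by (intro continuous_intros)
  qed
  then have "0 \<le> d t * exp (- Q t)" using init by (meson exp_ge_zero mult_nonneg_nonneg order_trans)
  then show ?thesis by (simp add: zero_le_mult_iff)
qed

lemma supersolution_bound:
  fixes w g q \<beta> \<beta>' :: "real \<Rightarrow> real"
  assumes "s \<le> t"
    and w: "\<And>r. (w has_real_derivative q r * w r + g r) (at r)"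
    and cont: "continuous_on UNIV q"
    and g: "\<And>r. \<bar>g r\<bar> \<le> \<delta>"
    and \<beta>: "\<And>r. (\<beta> has_real_derivative \<beta>' r) (at r)"
    and super: "\<And>r. s \<le> r \<Longrightarrow> r \<le> t \<Longrightarrow> q r * \<beta> r + \<delta> \<le> \<beta>' r"
    and init: "\<bar>w s\<bar> \<le> \<beta> s"
  shows "\<bar>w t\<bar> \<le> \<beta> t"
proof -
  have "0 \<le> \<beta> t - w t"
  proof (rule comparison_principle[OF \<open>s \<le> t\<close> _ cont])
    show "((\<lambda>r. \<beta> r - w r) has_real_derivative \<beta>' r - (q r * w r + g r)) (at r)" for r
      by (intro derivative_intros \<beta> w)
    show "q r * (\<beta> r - w r) \<le> \<beta>' r - (q r * w r + g r)" if "s \<le> r" "r \<le> t" for r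
      using super[OF that] g[of r] by (simp add: algebra_simps)
  qed (use init in auto)
  moreover have "0 \<le> \<beta> t + w t"
  proof (rule comparison_principle[OF \<open>s \<le> t\<close> _ cont])
    show "((\<lambda>r. \<beta> r + w r) has_real_derivative \<beta>' r + (q r * w r + g r)) (at r)" for r
      by (intro derivative_intros \<beta> w)
    show "q r * (\<beta> r + w r) \<le> \<beta>' r + (q r * w r + g r)" if "s \<le> r" "r \<le> t" for r
      using super[OF that] g[of r] by (simp add: algebra_simps)
  qed (use init in auto)
  ultimately show ?thesis by linarith
qed

text \<open>The coefficient \<open>a - 1\<close> is at most \<open>-1\<close> except on a time window of length \<open>T\<close>.  Up to \<open>t\<^sub>0\<close> the
  influence of the value at time \<open>s\<close> is at most \<open>M * exp (- (t - s))\<close> and vanishes as \<open>s \<rightarrow> -\<infinity>\<close>, which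
  leaves \<open>\<bar>w\<bar> \<le> \<delta>\<close>.  In the window this grows to at most \<open>2 * exp (A * T) * \<delta>\<close>, and after it the
  source can add at most \<open>\<delta>\<close>.\<close>

lemma bounded_entire_solution_bound:
  fixes w g a :: "real \<Rightarrow> real"
  assumes w: "\<And>r. (w has_real_derivative (a r - 1) * w r + g r) (at r)"
    and cont: "continuous_on UNIV a"
    and g: "\<And>r. \<bar>g r\<bar> \<le> \<delta>"
    and bounded: "\<And>r. \<bar>w r\<bar> \<le> M"
    and A: "\<And>r. a r \<le> A" "0 \<le> A"
    and outside: "\<And>r. r \<le> t\<^sub>0 \<or> t\<^sub>0 + T \<le> r \<Longrightarrow> a r \<le> 0" and "0 \<le> T"
  shows "\<bar>w t\<bar> \<le> 3 * exp (A * T) * \<delta>"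
proof -
  have \<delta>: "0 \<le> \<delta>" using order_trans[OF abs_ge_zero g] .
  have cont': "continuous_on UNIV (\<lambda>r. a r - 1)" by (intro continuous_intros cont)
  have decay: "\<bar>w t\<bar> \<le> \<bar>w s\<bar> * exp (- (t - s)) + \<delta>"
    if "s \<le> t" "\<And>r. s \<le> r \<Longrightarrow> r \<le> t \<Longrightarrow> a r \<le> 0" for s t
  proof (rule supersolution_bound[where \<beta> = "\<lambda>r. \<bar>w s\<bar> * exp (- (r - s)) + \<delta>"
        and \<beta>' = "\<lambda>r. - \<bar>w s\<bar> * exp (- (r - s))", OF \<open>s \<le> t\<close> w cont' g])
    show "((\<lambda>r. \<bar>w s\<bar> * exp (- (r - s)) + \<delta>) has_real_derivative - \<bar>w s\<bar> * exp (- (r - s))) (at r)" for r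
      by (auto intro!: derivative_eq_intros)
    show "(a r - 1) * (\<bar>w s\<bar> * exp (- (r - s)) + \<delta>) + \<delta> \<le> - \<bar>w s\<bar> * exp (- (r - s))"
      if "s \<le> r" "r \<le> t" for r
    proof -
      have "a r * (\<bar>w s\<bar> * exp (- (r - s)) + \<delta>) \<le> 0"
        using \<open>\<And>r. s \<le> r \<Longrightarrow> r \<le> t \<Longrightarrow> a r \<le> 0\<close>[OF that] \<delta> by (intro mult_nonpos_nonneg) auto
      then show ?thesis by (simp add: algebra_simps)
    qed
  qed (use \<delta> in auto)
  have growth: "\<bar>w t\<bar> \<le> (\<bar>w s\<bar> + \<delta>) * exp (A * (t - s))" if "s \<le> t" for s t
  proof (rule supersolution_bound[where \<beta> = "\<lambda>r. (\<bar>w s\<bar> + \<delta>) * exp (A * (r - s))"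
        and \<beta>' = "\<lambda>r. A * ((\<bar>w s\<bar> + \<delta>) * exp (A * (r - s)))", OF \<open>s \<le> t\<close> w cont' g])
    show "((\<lambda>r. (\<bar>w s\<bar> + \<delta>) * exp (A * (r - s))) has_real_derivative
        A * ((\<bar>w s\<bar> + \<delta>) * exp (A * (r - s)))) (at r)" for r
      by (auto intro!: derivative_eq_intros)
    show "(a r - 1) * ((\<bar>w s\<bar> + \<delta>) * exp (A * (r - s))) + \<delta> \<le> A * ((\<bar>w s\<bar> + \<delta>) * exp (A * (r - s)))"
      if "s \<le> r" "r \<le> t" for r
    proof -
      let ?\<beta> = "(\<bar>w s\<bar> + \<delta>) * exp (A * (r - s))"
      have "1 \<le> exp (A * (r - s))" using A that by simp
      then have "\<bar>w s\<bar> + \<delta> \<le> ?\<beta>" using \<delta> mult_left_mono[of 1 "exp (A * (r - s))" "\<bar>w s\<bar> + \<delta>"] by simp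
      then have "\<delta> \<le> ?\<beta>" "0 \<le> ?\<beta>" using \<delta> by auto
      moreover have "a r * ?\<beta> \<le> A * ?\<beta>" using A(1) \<open>0 \<le> ?\<beta>\<close> by (rule mult_right_mono)
      ultimately show ?thesis unfolding left_diff_distrib by simp
    qed
  qed (use \<delta> in auto)
  have before: "\<bar>w t\<bar> \<le> \<delta>" if "t \<le> t\<^sub>0" for t
  proof -
    have "((\<lambda>s. M * exp (s - t) + \<delta>) \<longlongrightarrow> M * 0 + \<delta>) at_bot"
    proof (intro tendsto_intros filterlim_compose[OF exp_at_bot])
      show "filterlim (\<lambda>s. s - t) at_bot at_bot"
        unfolding filterlim_at_bot
      proof
        fix Z
        show "\<forall>\<^sub>F s in at_bot. s - t \<le> Z"
          using eventually_le_at_bot[of "Z + t"] by eventually_elim simp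
      qed
    qed
    moreover have "\<forall>\<^sub>F s in at_bot. \<bar>w t\<bar> \<le> M * exp (s - t) + \<delta>"
      using eventually_le_at_bot[of t]
    proof eventually_elim
      case (elim s)
      then have "\<bar>w t\<bar> \<le> \<bar>w s\<bar> * exp (- (t - s)) + \<delta>" using decay outside that by auto
      also have "\<dots> \<le> M * exp (- (t - s)) + \<delta>" using bounded by (intro add_right_mono mult_right_mono) auto
      finally show ?case by simp
    qed
    ultimately show ?thesis
      using tendsto_lowerbound[of "\<lambda>s. M * exp (s - t) + \<delta>" "M * 0 + \<delta>" at_bot "\<bar>w t\<bar>"] by simp
  qed
  have during: "\<bar>w t\<bar> \<le> 2 * exp (A * T) * \<delta>" if "t\<^sub>0 \<le> t" "t \<le> t\<^sub>0 + T" for t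
  proof -
    have "\<bar>w t\<bar> \<le> (\<bar>w t\<^sub>0\<bar> + \<delta>) * exp (A * (t - t\<^sub>0))" using growth that by simp
    also have "\<dots> \<le> (2 * \<delta>) * exp (A * T)"
      using before[of t\<^sub>0] that A \<delta> by (intro mult_mono) (auto intro!: mult_left_mono)
    finally show ?thesis by (simp add: mult_ac)
  qed
  have big: "\<delta> \<le> exp (A * T) * \<delta>" using A \<open>0 \<le> T\<close> \<delta> by (simp add: mult_le_cancel_right1)
  consider "t \<le> t\<^sub>0" | "t\<^sub>0 \<le> t" "t \<le> t\<^sub>0 + T" | "t\<^sub>0 + T \<le> t" by linarith
  then show ?thesis
  proof cases
    case 1
    then show ?thesis using before big \<delta> by fastforce
  next
    case 2
    then show ?thesis using during[of t] big \<delta> by simp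
  next
    case 3
    have "\<bar>w t\<bar> \<le> \<bar>w (t\<^sub>0 + T)\<bar> * exp (- (t - (t\<^sub>0 + T))) + \<delta>" using decay outside 3 by auto
    also have "\<dots> \<le> \<bar>w (t\<^sub>0 + T)\<bar> * 1 + \<delta>" using 3 by (intro add_right_mono mult_left_mono) auto
    finally show ?thesis using during[of "t\<^sub>0 + T"] \<open>0 \<le> T\<close> big by simp
  qed
qed


section \<open>Kernel and reaction\<close>

context dispersal_kernel
begin

lemma J_has_derivative: "(J has_real_derivative deriv J x) (at x)"
  and continuous_deriv_J: "continuous_on UNIV (deriv J)"
proof -
  obtain D where D: "\<And>x. (J has_real_derivative D x) (at x)" "continuous_on UNIV D"
    using J_C1 by (auto simp: C1_differentiable_on_def has_real_derivative_iff_has_vector_derivative)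
  then have "deriv J = D" by (auto intro: DERIV_imp_deriv)
  then show "(J has_real_derivative deriv J x) (at x)" "continuous_on UNIV (deriv J)"
    using D by auto
qed

lemma integrable_deriv_J: "integrable lborel (deriv J)"
  using J_deriv_integrable borel_measurable_continuous_onI[OF continuous_deriv_J]
  by (simp add: integrable_abs_iff)

end

context ignition_reaction
begin

lemma f_has_derivative_u:
  assumes "0 \<le> w"
  shows "(f t has_real_derivative f_u f t w) (at w within {0..})"
    and "(f_u f t has_real_derivative f_uu f t w) (at w within {0..})"
proof -
  have deriv: "(F has_real_derivative deriv_on {0..} F w) (at w within {0..})"
    if "C1_on {0..} F" for F
    using that assms
    by (auto simp: C1_on_def differentiable_on_def deriv_on_def vector_derivative_works[symmetric]
        has_real_derivative_iff_has_vector_derivative)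
  have "deriv_on {0..} (f t) = f_u f t" by (simp add: f_u_def fun_eq_iff)
  then show "(f t has_real_derivative f_u f t w) (at w within {0..})"
    "(f_u f t has_real_derivative f_uu f t w) (at w within {0..})"
    using f_C2_in_u[of t] deriv[of "f t"] deriv[of "f_u f t"] by (simp_all add: C2_on_def f_uu_def)
qed

lemma f_taylor_u:
  obtains K where "0 \<le> K"
    and "\<And>t w w'. w \<in> {0..1} \<Longrightarrow> w' \<in> {0..1} \<Longrightarrow>
      \<bar>f t w' - f t w - f_u f t w * (w' - w)\<bar> \<le> K * (w' - w)\<^sup>2"
proof -
  obtain K where K: "\<And>t w. w \<in> {0..1} \<Longrightarrow> \<bar>f_uu f t w\<bar> \<le> K"
    using f_uu_bounded by (force simp: bdd_above_def)
  then have "0 \<le> K" using order_trans[OF abs_ge_zero K[of 0 0]] by simp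
  have sub: "(F has_real_derivative D) (at w within {0..1})"
    if "(F has_real_derivative D) (at w within {0..})" for F D and w :: real
    using that by (rule DERIV_subset) auto
  have lip: "\<bar>f_u f t w - f_u f t w'\<bar> \<le> K * \<bar>w - w'\<bar>" if "w \<in> {0..1}" "w' \<in> {0..1}" for t w w'
    using field_differentiable_bound[of "{0..1}" "f_u f t" "f_uu f t" K w w'] that
      sub[OF f_has_derivative_u(2)] K by auto
  have "\<bar>f t w' - f t w - f_u f t w * (w' - w)\<bar> \<le> K * (w' - w)\<^sup>2"
    if "w \<in> {0..1}" "w' \<in> {0..1}" for t w w'
    using that lip \<open>0 \<le> K\<close> sub[OF f_has_derivative_u(1)]
    by (intro taylor_remainder_of_Lipschitz_derivative[where S = "{0..1}"]) auto
  with \<open>0 \<le> K\<close> show ?thesis using that by blast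
qed

text \<open>On \<open>[0, \<theta>]\<close> the reaction is squeezed between \<open>f\<^sub>m\<^sub>i\<^sub>n = 0\<close> and \<open>f\<^sub>m\<^sub>a\<^sub>x = 0\<close>.  Restricting the
  derivative to this interval settles the end point \<open>w = \<theta>\<close> as well.\<close>

lemma f_u_eq_0_below_ignition:
  assumes "w \<in> {0..\<theta>}"
  shows "f_u f t w = 0"
proof (rule vector_derivative_unique_within_closed_interval[of 0 \<theta> w "f t"])
  show "0 < \<theta>" "w \<in> cbox 0 \<theta>" using theta assms by auto
  show "(f t has_vector_derivative f_u f t w) (at w within cbox 0 \<theta>)"
    using DERIV_subset[OF f_has_derivative_u(1), of w "cbox 0 \<theta>" t] assms
    by (auto simp: has_real_derivative_iff_has_vector_derivative)
  have zero: "f t v = 0" if "v \<in> cbox 0 \<theta>" for v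
    using f_between[of v t] f_min_max_zero[of v] that theta by auto
  show "(f t has_vector_derivative 0) (at w within cbox 0 \<theta>)"
    by (rule has_vector_derivative_transform[OF _ zero has_vector_derivative_const]) (use assms in auto)
qed

lemma f_u_upper_bound:
  obtains A where "0 \<le> A" and "\<And>t w. 0 \<le> w \<Longrightarrow> f_u f t w \<le> A"
proof -
  obtain A where A: "\<And>t w. 0 \<le> w \<Longrightarrow> \<bar>f_u f t w\<bar> \<le> A"
    using f_u_bounded by (force simp: bdd_above_def)
  then show ?thesis using that[of A] order_trans[OF abs_ge_zero A[of 0 0]] abs_le_D1 by force
qed

end

section \<open>The front\<close>

context limiting_transition_front
begin

lemma
  shows u_continuous: "continuous_on UNIV (\<lambda>(t, x). u t x)"
    and u_nonneg: "0 \<le> u t x"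
    and u_equation: "((\<lambda>\<tau>. u \<tau> x) has_real_derivative
      (conv J (u t) x - u t x + f t (u t x))) (at t)"
  using front by (auto simp: transition_front_def classical_solution_def)

lemma u_le_1: "u t x \<le> 1"
proof (rule tendsto_lowerbound)
  show "(u t \<longlongrightarrow> 1) at_bot" using front by (simp add: transition_front_def)
  show "\<forall>\<^sub>F y in at_bot. u t x \<le> u t y"
    using eventually_le_at_bot[of x]
    by eventually_elim (metis u_decreasing less_eq_real_def)
qed simp

lemma X_grows:
  assumes "s \<le> t"
  shows "c_min * (t - s) \<le> X t - X s"
proof -
  have "X s - c_min * s \<le> X t - c_min * t"
  proof (rule DERIV_nonneg_imp_nondecreasing[OF assms])
    fix r
    obtain D where "(X has_real_derivative D r) (at r)"
      using X_C1
      by (auto simp: C1_differentiable_on_def has_real_derivative_iff_has_vector_derivative[symmetric])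
    then have "(X has_real_derivative deriv X r) (at r)" by (simp add: DERIV_imp_deriv)
    then have "((\<lambda>r. X r - c_min * r) has_real_derivative deriv X r - c_min) (at r)"
      by (auto intro!: derivative_eq_intros)
    then show "\<exists>y. ((\<lambda>r. X r - c_min * r) has_real_derivative y) (at r) \<and> 0 \<le> y"
      using X_speed[of r] by force
  qed
  then show ?thesis by (simp add: algebra_simps)
qed

lemma X_surj: obtains t where "X t = z"
proof -
  define m where "m = (z - X 0) / c_min"
  have m: "c_min * m = z - X 0" using constants_pos by (simp add: m_def)
  have cont: "continuous_on UNIV X" using X_C1 by (rule C1_differentiable_imp_continuous_on)
  show ?thesis
  proof (cases "0 \<le> m")
    case True
    then have "X 0 \<le> z" "z \<le> X m" using X_grows[of 0 m] m constants_pos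
      by (auto simp: m_def divide_simps split: if_splits)
    then show ?thesis using IVT'[of X 0 z m] True that continuous_on_subset[OF cont] by blast
  next
    case False
    then have "z \<le> X 0" "X m \<le> z" using X_grows[of m 0] m constants_pos
      by (auto simp: m_def divide_simps split: if_splits)
    then show ?thesis using IVT'[of X m z 0] False that continuous_on_subset[OF cont] by force
  qed
qed

text \<open>The linearised reaction can be destabilising at \<open>x\<close> only while \<open>u\<close> lies between \<open>\<theta>\<close> and \<open>\<theta>'\<close>.
  The exponential bounds confine this to times at which \<open>X\<close> is between \<open>x - a\<close> and \<open>x + b\<close>, a
  distance that \<open>X\<close> covers in time at most \<open>(a + b) / c_min\<close>.\<close>

lemma transition_time_bounded:
  obtains T where "0 \<le> T"
    and "\<And>x. \<exists>t\<^sub>0. \<forall>r. r \<le> t\<^sub>0 \<or> t\<^sub>0 + T \<le> r \<longrightarrow> f_u f r (u r x) \<le> 0"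
proof -
  obtain \<theta>' where \<theta>': "\<theta> < \<theta>'" "\<theta>' < 1" "\<And>t w. w \<in> {\<theta>'..1} \<Longrightarrow> f_u f t w \<le> 0"
    using f_u_nonpos by blast
  \<comment> \<open>The distances at which the exponential bounds reach the values \<open>\<theta>\<close> and \<open>\<theta>'\<close>.\<close>
  define a where "a = h_plus - ln \<theta> / c_plus"
  define b where "b = h_minus - ln (1 - \<theta>') / c_minus"
  define T where "T = (a + b) / c_min"
  have "ln \<theta> \<le> 0" "ln (1 - \<theta>') \<le> 0" using theta \<theta>' by auto
  then have "ln \<theta> / c_plus \<le> 0" "ln (1 - \<theta>') / c_minus \<le> 0" 
    using constants_pos by (auto simp: divide_nonpos_pos)
  then have ab: "h_plus \<le> a" "h_minus \<le> b" by (auto simp: a_def b_def)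
  then have "0 \<le> T" using constants_pos by (auto simp: T_def)
  have early: "u r x \<le> \<theta>" if "X r + a \<le> x" for r x
  proof -
    have "u r x \<le> exp (- c_plus * (x - X r - h_plus))" using u_ahead that ab by auto
    also have "\<dots> \<le> exp (- c_plus * (a - h_plus))" using that constants_pos by simp
    also have "\<dots> = \<theta>" using constants_pos theta by (simp add: a_def)
    finally show ?thesis .
  qed
  have late: "\<theta>' \<le> u r x" if "x + b \<le> X r" for r x
  proof -
    have "\<theta>' = 1 - exp (c_minus * (h_minus - b))" using constants_pos \<theta>' by (simp add: b_def)
    also have "\<dots> \<le> 1 - exp (c_minus * (x - X r + h_minus))" using that constants_pos by simp
    also have "\<dots> \<le> u r x" using u_behind that ab by auto
    finally show ?thesis .
  qed
  have "\<exists>t\<^sub>0. \<forall>r. r \<le> t\<^sub>0 \<or> t\<^sub>0 + T \<le> r \<longrightarrow> f_u f r (u r x) \<le> 0" for x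
  proof -
    obtain t\<^sub>0 where t0: "X t\<^sub>0 = x - a" using X_surj .
    have "f_u f r (u r x) \<le> 0" if "r \<le> t\<^sub>0" for r
    proof -
      have "0 \<le> c_min * (t\<^sub>0 - r)" using that constants_pos by simp
      then have "X r + a \<le> x" using X_grows[OF that] t0 by simp
      then show ?thesis using early u_nonneg f_u_eq_0_below_ignition by simp
    qed
    moreover have "f_u f r (u r x) \<le> 0" if "t\<^sub>0 + T \<le> r" for r
    proof -
      have "c_min * T \<le> c_min * (r - t\<^sub>0)" using that constants_pos by simp
      also have "c_min * T = a + b" using constants_pos by (simp add: T_def)
      finally have "x + b \<le> X r" using X_grows[of t\<^sub>0 r] t0 that \<open>0 \<le> T\<close> by simp
      then show ?thesis using late u_le_1 \<theta>'(3) by simp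
    qed
    ultimately show ?thesis by blast
  qed
  with \<open>0 \<le> T\<close> show ?thesis using that by blast
qed

text \<open>Subtracting the equations at \<open>x + h\<close> and \<open>x\<close> and dividing by \<open>h\<close> gives the equation of \<open>Q h\<close>.  Both
  the coefficient \<open>a\<close> and the source \<open>J' * u\<close> are taken at \<open>x\<close>, the nonlinear effects going into the
  remainders \<open>RJ\<close> and \<open>Rf\<close>, so that in \<open>Q h - Q k\<close> the source cancels and only the remainders force
  the equation.\<close>

lemma difference_quotients_uniformly_Cauchy:
  "\<exists>C. \<forall>t x h k. h \<noteq> 0 \<longrightarrow> k \<noteq> 0 \<longrightarrow>
    \<bar>(u t (x + h) - u t x) / h - (u t (x + k) - u t x) / k\<bar> \<le> C * (\<bar>h\<bar> + \<bar>k\<bar>)"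
proof -
  obtain L where L: "\<And>t. L-lipschitz_on UNIV (u t)" using u_Lipschitz by blast
  have lip: "\<bar>u t x - u t y\<bar> \<le> L * \<bar>x - y\<bar>" for t x y
    using lipschitz_onD[OF L, of x y t] by (simp add: dist_real_def)
  have "0 \<le> L" using lipschitz_on_nonneg[OF L] .
  obtain K where K: "0 \<le> K" "\<And>t w w'. w \<in> {0..1} \<Longrightarrow> w' \<in> {0..1} \<Longrightarrow>
      \<bar>f t w' - f t w - f_u f t w * (w' - w)\<bar> \<le> K * (w' - w)\<^sup>2"
    using f_taylor_u by blast
  obtain A where A: "0 \<le> A" "\<And>t w. 0 \<le> w \<Longrightarrow> f_u f t w \<le> A" using f_u_upper_bound by blast
  obtain T where T: "0 \<le> T" "\<And>x. \<exists>t\<^sub>0. \<forall>r. r \<le> t\<^sub>0 \<or> t\<^sub>0 + T \<le> r \<longrightarrow> f_u f r (u r x) \<le> 0"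
    using transition_time_bounded by blast
  define B where "B = 2 * (L * (LBINT z. \<bar>deriv J z\<bar>)) + K * L\<^sup>2"
  have "\<bar>(u t (x + h) - u t x) / h - (u t (x + k) - u t x) / k\<bar>
      \<le> (3 * exp (A * T) * B) * (\<bar>h\<bar> + \<bar>k\<bar>)" if "h \<noteq> 0" "k \<noteq> 0" for t x h k
  proof -
    define a where "a r = f_u f r (u r x)" for r
    define Q where "Q h r = (u r (x + h) - u r x) / h" for h r
    define RJ where "RJ h r = conv J (u r) (x + h) - conv J (u r) x - h * conv (deriv J) (u r) x" for h r
    define Rf where "Rf h r = f r (u r (x + h)) - f r (u r x) - a r * (u r (x + h) - u r x)" for h r
    define g where "g h r = (RJ h r + Rf h r) / h" for h r
    have Q_bound: "\<bar>Q h r\<bar> \<le> L" if "h \<noteq> 0" for h r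
      using lip[of r "x + h" x] that by (simp add: Q_def abs_divide divide_simps)
    have g_bound: "\<bar>g h r\<bar> \<le> B * \<bar>h\<bar>" if "h \<noteq> 0" for h r
    proof -
      have "continuous_on UNIV (u r)" using L by (rule lipschitz_on_continuous_on)
      then have "u r \<in> borel_measurable borel" by (rule borel_measurable_continuous_onI)
      then have 1: "\<bar>RJ h r\<bar> \<le> 2 * (L * (LBINT z. \<bar>deriv J z\<bar>)) * h\<^sup>2"
        unfolding RJ_def using u_nonneg[of r] u_le_1[of r]
        by (intro conv_taylor J_integrable integrable_deriv_J J_has_derivative continuous_deriv_J lip)
          (auto simp: abs_le_iff intro: order_trans[of _ 0])
      have "\<bar>Rf h r\<bar> \<le> K * (u r (x + h) - u r x)\<^sup>2"
        unfolding Rf_def a_def using u_nonneg u_le_1 by (intro K(2)) auto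
      also have "(u r (x + h) - u r x)\<^sup>2 \<le> (L * h)\<^sup>2"
        using lip[of r "x + h" x] \<open>0 \<le> L\<close> by (simp add: abs_le_square_iff[symmetric] abs_mult)
      finally have 2: "\<bar>Rf h r\<bar> \<le> K * L\<^sup>2 * h\<^sup>2" using \<open>0 \<le> K\<close> by (simp add: power_mult_distrib mult_left_mono)
      have "\<bar>RJ h r + Rf h r\<bar> \<le> B * h\<^sup>2" using 1 2 by (simp add: B_def algebra_simps)
      also have "\<dots> = B * \<bar>h\<bar> * \<bar>h\<bar>" by (simp add: power2_eq_square)
      finally show ?thesis using that by (simp add: g_def abs_divide divide_simps)
    qed
    have Q_eq: "(Q h has_real_derivative (a r - 1) * Q h r + conv (deriv J) (u r) x + g h r) (at r)"
      if "h \<noteq> 0" for h r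
    proof -
      have "(Q h has_real_derivative
          ((conv J (u r) (x + h) - u r (x + h) + f r (u r (x + h)))
            - (conv J (u r) x - u r x + f r (u r x))) / h) (at r)"
        unfolding Q_def[abs_def] by (intro DERIV_cdivide DERIV_diff u_equation)
      moreover have "((conv J (u r) (x + h) - u r (x + h) + f r (u r (x + h)))
            - (conv J (u r) x - u r x + f r (u r x))) / h
          = (a r - 1) * Q h r + conv (deriv J) (u r) x + g h r"
        using that by (simp add: Q_def g_def RJ_def Rf_def field_simps)
      ultimately show ?thesis by simp
    qed
    obtain t\<^sub>0 where t0: "\<And>r. r \<le> t\<^sub>0 \<or> t\<^sub>0 + T \<le> r \<Longrightarrow> a r \<le> 0"
      using T(2)[of x] unfolding a_def by blast
    have "\<bar>Q h t - Q k t\<bar> \<le> 3 * exp (A * T) * (B * \<bar>h\<bar> + B * \<bar>k\<bar>)"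
    proof (rule bounded_entire_solution_bound[where a = a and M = "2 * L" and t\<^sub>0 = t\<^sub>0
          and g = "\<lambda>r. g h r - g k r" and w = "\<lambda>r. Q h r - Q k r"])
      show "((\<lambda>r. Q h r - Q k r) has_real_derivative
          (a r - 1) * (Q h r - Q k r) + (g h r - g k r)) (at r)" for r
        using DERIV_diff[OF Q_eq[OF \<open>h \<noteq> 0\<close>] Q_eq[OF \<open>k \<noteq> 0\<close>], of r] by (simp add: algebra_simps)
      have u_path: "continuous_on UNIV (\<lambda>r. u r x)"
        using continuous_on_compose2[OF u_continuous, of UNIV "\<lambda>r. (r, x)"]
        by (simp add: continuous_on_Pair)
      show "continuous_on UNIV a"
        using continuous_on_compose2[OF f_u_continuous, of UNIV "\<lambda>r. (r, u r x)"] u_nonneg u_path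
        by (auto simp: a_def[abs_def] continuous_on_Pair)
      show "\<bar>g h r - g k r\<bar> \<le> B * \<bar>h\<bar> + B * \<bar>k\<bar>" for r
        using g_bound[OF \<open>h \<noteq> 0\<close>, of r] g_bound[OF \<open>k \<noteq> 0\<close>, of r] by linarith
      show "\<bar>Q h r - Q k r\<bar> \<le> 2 * L" for r
        using Q_bound[OF \<open>h \<noteq> 0\<close>, of r] Q_bound[OF \<open>k \<noteq> 0\<close>, of r] by linarith
    qed (use A T(1) t0 u_nonneg in \<open>auto simp: a_def\<close>)
    then show ?thesis by (simp add: Q_def algebra_simps)
  qed
  then show ?thesis by blast
qed

end

theorem theorem1p2:
  fixes J :: "real \<Rightarrow> real" and f :: "real \<Rightarrow> real \<Rightarrow> real"
    and f_min f_max :: "real \<Rightarrow> real" and \<theta> :: real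
    and c_star :: real and \<phi>_min :: "real \<Rightarrow> real" and y :: "real \<Rightarrow> real"
    and U :: "real \<Rightarrow> real \<Rightarrow> real \<Rightarrow> real" and \<xi> :: "real \<Rightarrow> real \<Rightarrow> real"
    and c_min c_max c_minus c_plus h_minus h_plus :: real
    and \<sigma> :: "nat \<Rightarrow> real" and u :: "real \<Rightarrow> real \<Rightarrow> real" and X :: "real \<Rightarrow> real"
  assumes "limiting_transition_front J f f_min f_max \<theta> c_star \<phi>_min y U \<xi>
             c_min c_max c_minus c_plus h_minus h_plus \<sigma> u X"
  shows "(\<forall>t. u t C1_differentiable_on UNIV) \<and>
    bdd_above (range (\<lambda>(t, x). \<bar>deriv (u t) x\<bar>)) \<and>
    bdd_above {\<bar>(deriv (u t) x - deriv (u t) x') / (x - x')\<bar> | t x x'. x \<noteq> x'}"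
proof -
  interpret limiting_transition_front J f f_min f_max \<theta> c_star \<phi>_min y U \<xi>
    c_min c_max c_minus c_plus h_minus h_plus \<sigma> u X by fact
  obtain C where C: "\<And>t x h k. h \<noteq> 0 \<Longrightarrow> k \<noteq> 0 \<Longrightarrow>
    \<bar>(u t (x + h) - u t x) / h - (u t (x + k) - u t x) / k\<bar> \<le> C * (\<bar>h\<bar> + \<bar>k\<bar>)"
    using difference_quotients_uniformly_Cauchy by blast
  have D: "(u t has_real_derivative deriv (u t) x) (at x)" for t x
    by (rule derivative_of_Cauchy_difference_quotients(1)[OF C])
  have D_lip: "\<bar>deriv (u t) x - deriv (u t) x'\<bar> \<le> 2 * C * \<bar>x - x'\<bar>" for t x x'
    by (rule derivative_of_Cauchy_difference_quotients(2)[OF C])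
  have "0 \<le> 2 * C" using order_trans[OF abs_ge_zero D_lip[of 0 1 0]] by simp
  then have "(2 * C)-lipschitz_on UNIV (deriv (u t))" for t
    using D_lip by (auto intro!: lipschitz_onI simp: dist_real_def)
  then have "continuous_on UNIV (deriv (u t))" for t by (rule lipschitz_on_continuous_on)
  then have 1: "\<forall>t. u t C1_differentiable_on UNIV"
    using D by (auto simp: C1_differentiable_on_def has_real_derivative_iff_has_vector_derivative)
  obtain L where L: "\<And>t. L-lipschitz_on UNIV (u t)" using u_Lipschitz by blast
  \<comment> \<open>The derivative inherits the bound \<open>L\<close> of the difference quotients.\<close>
  have "\<bar>deriv (u t) x\<bar> \<le> L" for t x
  proof (rule tendsto_upperbound)
    show "((\<lambda>y. \<bar>(u t y - u t x) / (y - x)\<bar>) \<longlongrightarrow> \<bar>deriv (u t) x\<bar>) (at x)"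
      using D[of t x] unfolding has_field_derivative_iff by (rule tendsto_rabs)
    show "\<forall>\<^sub>F y in at x. \<bar>(u t y - u t x) / (y - x)\<bar> \<le> L"
      unfolding eventually_at_filter
      using lipschitz_onD[OF L, of _ x t] by (auto simp: dist_real_def abs_divide divide_simps)
  qed simp
  then have 2: "bdd_above (range (\<lambda>(t, x). \<bar>deriv (u t) x\<bar>))" by (auto intro!: bdd_aboveI[of _ L])
  have "\<bar>(deriv (u t) x - deriv (u t) x') / (x - x')\<bar> \<le> 2 * C" if "x \<noteq> x'" for t x x'
    using D_lip[of t x x'] that by (simp add: abs_divide pos_divide_le_eq)
  then have 3: "bdd_above {\<bar>(deriv (u t) x - deriv (u t) x') / (x - x')\<bar> | t x x'. x \<noteq> x'}"
    by (intro bdd_aboveI[of _ "2 * C"]) auto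
  show ?thesis by (intro conjI 1 2 3)
qed

end
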